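(* Let $\{(b_i,d_i)\}_{i=1}^N$ be a persistence diagram, let $k\ge1$ be an integer and $m\in\mathbb{R}$. The Shapley value $\varphi(v_{(k,m)})$ is the only credit allocation for the game $v_{(k,m)}$ given by a rule satisfying the Efficiency, Symmetry, Linearity and Null player axioms. That is, $\varphi$ satisfies these four axioms, and if $\psi$ is any credit allocation rule on cooperative games with player set $\{1,\dots,N\}$ satisfying the four axioms, then $\psi_i(v_{(k,m)})=\varphi_i(v_{(k,m)})$ for every $i\in\{1,\dots,N\}$.
   Context: A persistence diagram here is a finite indexed family of points $(b_i,d_i)\in\mathbb{R}^2$ with $b_i\le d_i$, $i=1,\dots,N$, $N\ge1$. The tent function of point $i$ is $\ell_i(m)=\min(\max(0,m-b_i),\max(0,d_i-m))$. The landscape game $v_{(k,m)}$ on the player set $\{1,\dots,N\}$ is $v_{(k,m)}(S)=$ the $k$-th largest value (with multiplicity) among $\{\ell_i(m): i\in S\}$ if $|S|\ge k$, and $0$ if $|S|<k$. A cooperative game on the player set $\{1,\dots,N\}$ is a function $v:2^{\{1,\dots,N\}}\to\mathbb{R}$ with $v(\varnothing)=0$. A credit allocation rule $\psi$ assigns to each such game $v$ a vector $(\psi_1(v),\dots,\psi_N(v))\in\mathbb{R}^N$. The axioms, for all games $v,w$ on $\{1,\dots,N\}$, are: Efficiency: $\sum_{i=1}^N\psi_i(v)=v(\{1,\dots,N\})$. Symmetry: if $v(S\cup\{i\})=v(S\cup\{j\})$ for all $S$ with $i,j\notin S$, then $\psi_i(v)=\psi_j(v)$. Linearity: $\psi_i(v+w)=\psi_i(v)+\psi_i(w)$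 for all $i$, where $(v+w)(S)=v(S)+w(S)$. Null player: if $v(S\cup\{i\})=v(S)$ for all coalitions $S$, then $\psi_i(v)=0$. The Shapley value is $\varphi_i(v)=\frac1N\sum_{S\subset\{1,\dots,N\}\setminus\{i\}}\binom{N-1}{|S|}^{-1}(v(S\cup\{i\})-v(S))$. *)

theory Defs
  imports Complex_Main "HOL-Library.Multiset"
begin

definition persistence_diagram :: "nat \<Rightarrow> (nat \<Rightarrow> real) \<Rightarrow> (nat \<Rightarrow> real) \<Rightarrow> bool" where
  "persistence_diagram N b d \<longleftrightarrow> 1 \<le> N \<and> (\<forall>i\<in>{1..N}. b i \<le> d i)"

definition tent :: "real \<Rightarrow> real \<Rightarrow> real \<Rightarrow> real" where
  "tent b d m = min (max 0 (m - b)) (max 0 (d - m))"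

(* Counted with multiplicity, from k = 1; unspecified unless 1 \<le> k \<le> size M. *)
definition kth_largest :: "nat \<Rightarrow> 'a::linorder multiset \<Rightarrow> 'a" where
  "kth_largest k M = rev (sorted_list_of_multiset M) ! (k - 1)"

(* A game on the players {1..N} only has values on subsets of {1..N}. It is represented by its
   extension by 0 to all sets, so that each game has exactly one representative and pointwise
   sums of representatives are again representatives. *)
definition games :: "nat \<Rightarrow> (nat set \<Rightarrow> real) set" where
  "games N = {v. v {} = 0 \<and> (\<forall>S. \<not> S \<subseteq> {1..N} \<longrightarrow> v S = 0)}"

definition landscape_game ::
  "nat \<Rightarrow> (nat \<Rightarrow> real) \<Rightarrow> (nat \<Rightarrow> real) \<Rightarrow> nat \<Rightarrow> real \<Rightarrow> nat set \<Rightarrow> real" where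
  "landscape_game N b d k m S =
     (if S \<subseteq> {1..N} \<and> k \<le> card S
      then kth_largest k (image_mset (\<lambda>i. tent (b i) (d i) m) (mset_set S))
      else 0)"

lemma landscape_game_in_games: "1 \<le> k \<Longrightarrow> landscape_game N b d k m \<in> games N"
  by (simp add: games_def landscape_game_def)

(* Only the values of a rule at games in games N and players in {1..N} are meaningful, and the
   axioms constrain only these. *)
type_synonym allocation_rule = "(nat set \<Rightarrow> real) \<Rightarrow> nat \<Rightarrow> real"

definition efficiency :: "nat \<Rightarrow> allocation_rule \<Rightarrow> bool" where
  "efficiency N \<psi> \<longleftrightarrow> (\<forall>v\<in>games N. (\<Sum>i\<in>{1..N}. \<psi> v i) = v {1..N})"

definition symmetry :: "nat \<Rightarrow> allocation_rule \<Rightarrow> bool" where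
  "symmetry N \<psi> \<longleftrightarrow>
     (\<forall>v\<in>games N. \<forall>i\<in>{1..N}. \<forall>j\<in>{1..N}.
        (\<forall>S. S \<subseteq> {1..N} \<and> i \<notin> S \<and> j \<notin> S \<longrightarrow> v (S \<union> {i}) = v (S \<union> {j}))
          \<longrightarrow> \<psi> v i = \<psi> v j)"

definition linearity :: "nat \<Rightarrow> allocation_rule \<Rightarrow> bool" where
  "linearity N \<psi> \<longleftrightarrow>
     (\<forall>v\<in>games N. \<forall>w\<in>games N. \<forall>i\<in>{1..N}. \<psi> (\<lambda>S. v S + w S) i = \<psi> v i + \<psi> w i)"

definition null_player :: "nat \<Rightarrow> allocation_rule \<Rightarrow> bool" where
  "null_player N \<psi> \<longleftrightarrow>
     (\<forall>v\<in>games N. \<forall>i\<in>{1..N}. (\<forall>S. S \<subseteq> {1..N} \<longrightarrow> v (S \<union> {i}) = v S) \<longrightarrow> \<psi> v i = 0)"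

definition shapley_axioms :: "nat \<Rightarrow> allocation_rule \<Rightarrow> bool" where
  "shapley_axioms N \<psi> \<longleftrightarrow>
     efficiency N \<psi> \<and> symmetry N \<psi> \<and> linearity N \<psi> \<and> null_player N \<psi>"

definition shapley :: "nat \<Rightarrow> allocation_rule" where
  "shapley N v i =
     1 / real N * (\<Sum>S\<in>Pow ({1..N} - {i}).
       inverse (real ((N - 1) choose card S)) * (v (S \<union> {i}) - v S))"

end

theory Submission
  imports Defs "HOL-Combinatorics.Transposition"
begin

text \<open>
  A rule satisfying the four axioms is forced on the scaled unanimity games \<open>c \<cdot> u\<^sub>T\<close>: players
  outside \<open>T\<close> are null players, players in \<open>T\<close> are symmetric, and so by efficiency each of the
  latter receives \<open>c / |T|\<close>. Every game is a sum of scaled unanimity games, so additivity determines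
  the rule on every game, in particular on the landscape game. For the Shapley value itself,
  efficiency holds because, after exchanging the sums, the coefficient of \<open>v T\<close> in \<open>\<Sum>i. \<phi>\<^sub>i v\<close>
  telescopes unless \<open>T\<close> is the grand coalition.
\<close>

section \<open>Unanimity games and uniqueness\<close>

definition unanimity_game :: "nat \<Rightarrow> real \<Rightarrow> nat set \<Rightarrow> nat set \<Rightarrow> real" where
  "unanimity_game N c T S = (if T \<subseteq> S \<and> S \<subseteq> {1..N} then c else 0)"

lemma unanimity_game_in_games: "T \<noteq> {} \<Longrightarrow> unanimity_game N c T \<in> games N"
  by (auto simp: games_def unanimity_game_def)

text \<open>Subtracting \<open>v T\<close> times the unanimity game of a minimal \<open>T\<close>
  with nonzero value removes \<open>T\<close> and leaves a game that is closer to zero. The scalar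
  \<open>c\<close> is kept inside \<open>unanimity_game\<close> because the linearity axiom is pure
  additivity and gives no homogeneity.\<close>

lemma games_induct [consumes 1, case_names zero unanimity add]:
  assumes "v \<in> games N"
    and zero: "P (\<lambda>S. 0)"
    and unanimity: "\<And>c T. T \<subseteq> {1..N} \<Longrightarrow> T \<noteq> {} \<Longrightarrow> P (unanimity_game N c T)"
    and add: "\<And>v w. v \<in> games N \<Longrightarrow> w \<in> games N \<Longrightarrow> P v \<Longrightarrow> P w \<Longrightarrow> P (\<lambda>S. v S + w S)"
  shows "P v"
proof -
  \<comment> \<open>The induction measure counts the upward closure of the support. The support
    itself may grow under the subtraction, which changes the value at every superset of
    \<open>T\<close>.\<close>
  define F where "F v = {S. S \<subseteq> {1..N} \<and> (\<exists>R\<subseteq>S. v R \<noteq> 0)}" for v :: "nat set \<Rightarrow> real"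
  have fin: "finite (F v)" for v
    by (rule finite_subset[of _ "Pow {1..N}"]) (auto simp: F_def)
  show ?thesis
    using assms(1)
  proof (induction "card (F v)" arbitrary: v rule: less_induct)
    case less
    show ?case
    proof (cases "v = (\<lambda>S. 0)")
      case True
      then show ?thesis using zero by simp
    next
      case False
      have sub: "S \<subseteq> {1..N}" if "v S \<noteq> 0" for S
        using less.prems that by (auto simp: games_def)
      from False obtain S where "v S \<noteq> 0" by auto
      then obtain T where T: "v T \<noteq> 0" and min: "\<And>S. v S \<noteq> 0 \<Longrightarrow> card T \<le> card S"
        using ex_has_least_nat[of "\<lambda>S. v S \<noteq> 0" S card] by blast
      have TA: "T \<subseteq> {1..N}" using T sub by blast
      have T0: "T \<noteq> {}" using T less.prems by (auto simp: games_def)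
      have minimal: "v R = 0" if "R \<subset> T" for R
        using that min[of R] psubset_card_mono[OF finite_subset[OF TA] that]
        by (auto simp: not_le[symmetric])
      define u where "u = unanimity_game N (v T) T"
      define w where "w = (\<lambda>S. v S - u S)"
      have u: "u \<in> games N" unfolding u_def using T0 by (rule unanimity_game_in_games)
      then have w: "w \<in> games N" using less.prems by (auto simp: games_def w_def)
      have "F w \<subseteq> F v"
      proof
        fix S assume "S \<in> F w"
        then obtain R where R: "S \<subseteq> {1..N}" "R \<subseteq> S" "w R \<noteq> 0" by (auto simp: F_def)
        \<comment> \<open>If \<open>T \<subseteq> R\<close>, then \<open>T\<close> itself witnesses
          \<open>S \<in> F v\<close>, since \<open>T \<subseteq> R \<subseteq> S\<close>.\<close>
        then have "v R \<noteq> 0 \<or> T \<subseteq> R" by (auto simp: w_def u_def unanimity_game_def split: if_splits)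
        then show "S \<in> F v" using R T unfolding F_def by blast
      qed
      moreover have "T \<in> F v" using T TA by (auto simp: F_def)
      moreover have "T \<notin> F w"
      proof -
        \<comment> \<open>At \<open>T\<close> the subtraction cancels the value; on proper subsets
          \<open>u\<close> is zero and \<open>v\<close> vanishes by minimality.\<close>
        have "w R = 0" if "R \<subseteq> T" for R
        proof (cases "R = T")
          case True
          then show ?thesis using TA by (simp add: w_def u_def unanimity_game_def)
        next
          case False
          then have "\<not> T \<subseteq> R" "v R = 0" using that minimal by auto
          then show ?thesis by (simp add: w_def u_def unanimity_game_def)
        qed
        then show ?thesis by (auto simp: F_def)
      qed
      ultimately have "F w \<subset> F v" by blast
      then have "card (F w) < card (F v)" by (rule psubset_card_mono[OF fin])
      then have "P w" using less.hyps w by blast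
      moreover have "P u" unfolding u_def using TA T0 by (rule unanimity)
      ultimately have "P (\<lambda>S. u S + w S)" using add u w by blast
      then show ?thesis by (simp add: w_def)
    qed
  qed
qed

lemma shapley_axioms_unanimity_game:
  assumes ax: "shapley_axioms N \<psi>" and T: "T \<subseteq> {1..N}" "T \<noteq> {}" and i: "i \<in> {1..N}"
  shows "\<psi> (unanimity_game N c T) i = (if i \<in> T then c / real (card T) else 0)"
proof -
  let ?u = "unanimity_game N c T"
  have g: "?u \<in> games N" using T(2) by (rule unanimity_game_in_games)
  have null: "\<psi> ?u j = 0" if "j \<in> {1..N} - T" for j
  proof -
    have "\<forall>S. S \<subseteq> {1..N} \<longrightarrow> ?u (S \<union> {j}) = ?u S"
      using that by (auto simp: unanimity_game_def)
    then show ?thesis using ax g that unfolding shapley_axioms_def null_player_def by blast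
  qed
  have sym: "\<psi> ?u j = \<psi> ?u l" if "j \<in> T" "l \<in> T" for j l
  proof (cases "j = l")
    case False
    \<comment> \<open>\<open>S \<union> {j}\<close> misses \<open>l\<close> and
      \<open>S \<union> {l}\<close> misses \<open>j\<close>, so neither contains \<open>T\<close>
      and both values are 0.\<close>
    then have "\<forall>S. S \<subseteq> {1..N} \<and> j \<notin> S \<and> l \<notin> S \<longrightarrow> ?u (S \<union> {j}) = ?u (S \<union> {l})"
      using that by (auto simp: unanimity_game_def)
    then show ?thesis
      using ax g that T(1) unfolding shapley_axioms_def symmetry_def by blast
  qed simp
  show ?thesis
  proof (cases "i \<in> T")
    case True
    have "c = ?u {1..N}" using T by (simp add: unanimity_game_def)
    also have "\<dots> = (\<Sum>j\<in>{1..N}. \<psi> ?u j)"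
      using ax g unfolding shapley_axioms_def efficiency_def by simp
    also have "\<dots> = (\<Sum>j\<in>T. \<psi> ?u j)"
      using T null by (intro sum.mono_neutral_right) auto
    also have "\<dots> = (\<Sum>j\<in>T. \<psi> ?u i)"
      by (intro sum.cong refl sym True)
    also have "\<dots> = real (card T) * \<psi> ?u i" by simp
    finally show ?thesis
      using True T finite_subset[OF T(1)] by (simp add: field_simps)
  next
    case False
    then show ?thesis using null i by simp
  qed
qed

theorem shapley_axioms_unique:
  assumes \<psi>: "shapley_axioms N \<psi>" and \<chi>: "shapley_axioms N \<chi>"
    and v: "v \<in> games N" and i: "i \<in> {1..N}"
  shows "\<psi> v i = \<chi> v i"
  using v
proof (induction rule: games_induct)
  case zero
  \<comment> \<open>Every player is a null player of the zero game.\<close>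
  have "(\<lambda>S. 0) \<in> games N" by (simp add: games_def)
  then show ?case
    using \<psi> \<chi> i unfolding shapley_axioms_def null_player_def by fastforce
next
  case (unanimity c T)
  then show ?case using \<psi> \<chi> i by (simp add: shapley_axioms_unanimity_game)
next
  case (add v w)
  then show ?case using \<psi> \<chi> i by (simp add: shapley_axioms_def linearity_def)
qed

section \<open>The Shapley value satisfies the axioms\<close>

lemma shapley_linearity: "linearity N (shapley N)"
  by (auto simp: linearity_def shapley_def algebra_simps sum.distrib sum_subtractf)

lemma shapley_null_player: "null_player N (shapley N)"
  unfolding null_player_def shapley_def
  by (auto intro!: sum.neutral)

text \<open>The transposition of \<open>i\<close> and \<open>j\<close> maps the coalitions avoiding
  \<open>i\<close> bijectively onto those avoiding \<open>j\<close>. It preserves cardinalities and,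
  for symmetric players, values of \<open>v\<close>, so the two sums agree term by term.\<close>

lemma shapley_symmetry: "symmetry N (shapley N)"
  unfolding symmetry_def
proof (intro ballI impI)
  fix v :: "nat set \<Rightarrow> real" and i j :: nat
  assume i: "i \<in> {1..N}" and j: "j \<in> {1..N}"
    and sym: "\<forall>S. S \<subseteq> {1..N} \<and> i \<notin> S \<and> j \<notin> S \<longrightarrow> v (S \<union> {i}) = v (S \<union> {j})"
  let ?\<sigma> = "(`) (transpose i j)"
  have inv: "v (?\<sigma> S) = v S" if "S \<subseteq> {1..N}" for S
  proof -
    \<comment> \<open>A coalition with both players or neither is fixed by the transposition;
      otherwise one player replaces the other, and the symmetry hypothesis applies to the remaining
      members.\<close>
    consider "i \<in> S \<longleftrightarrow> j \<in> S" | "i \<in> S" "j \<notin> S" | "i \<notin> S" "j \<in> S" by blast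
    then show ?thesis
    proof cases
      case 1
      then show ?thesis by simp
    next
      case 2
      let ?R = "S - {i}"
      have "?\<sigma> S = ?R \<union> {j}"
        using 2 by (auto simp: transpose_def image_iff)
      moreover have "v (?R \<union> {j}) = v (?R \<union> {i})"
      proof -
        have "?R \<subseteq> {1..N}" "i \<notin> ?R" "j \<notin> ?R" using that 2 by auto
        then show ?thesis using sym by metis
      qed
      moreover have "?R \<union> {i} = S" using 2 by blast
      ultimately show ?thesis by (simp only:)
    next
      case 3
      let ?R = "S - {j}"
      have "?\<sigma> S = ?R \<union> {i}"
        using 3 by (auto simp: transpose_def image_iff)
      moreover have "v (?R \<union> {i}) = v (?R \<union> {j})"
      proof -
        have "?R \<subseteq> {1..N}" "i \<notin> ?R" "j \<notin> ?R" using that 3 by auto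
        then show ?thesis using sym by metis
      qed
      moreover have "?R \<union> {j} = S" using 3 by blast
      ultimately show ?thesis by (simp only:)
    qed
  qed
  have \<sigma>A: "?\<sigma> S \<subseteq> {1..N}" if "S \<subseteq> {1..N}" for S
    using that i j by (auto simp: transpose_def)
  have \<sigma>\<sigma>: "?\<sigma> (?\<sigma> S) = S" for S by (simp add: image_comp)
  have "(\<Sum>S\<in>Pow ({1..N} - {i}). inverse (real ((N - 1) choose card S)) * (v (S \<union> {i}) - v S)) =
    (\<Sum>S\<in>Pow ({1..N} - {j}). inverse (real ((N - 1) choose card S)) * (v (S \<union> {j}) - v S))"
  proof (rule sum.reindex_bij_witness[of _ ?\<sigma> ?\<sigma>])
    fix S assume S: "S \<in> Pow ({1..N} - {i})"
    show "?\<sigma> S \<in> Pow ({1..N} - {j})"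
      using S \<sigma>A[of S] by (simp add: subset_Diff_insert in_transpose_image_iff)
    have "v (?\<sigma> S \<union> {j}) = v (?\<sigma> (S \<union> {i}))" by simp
    also have "\<dots> = v (S \<union> {i})" using S i by (intro inv) auto
    finally show "inverse (real ((N - 1) choose card (?\<sigma> S))) * (v (?\<sigma> S \<union> {j}) - v (?\<sigma> S)) =
        inverse (real ((N - 1) choose card S)) * (v (S \<union> {i}) - v S)"
      using S inv[of S] by (auto simp: card_image)
  next
    fix S assume S: "S \<in> Pow ({1..N} - {j})"
    show "?\<sigma> S \<in> Pow ({1..N} - {i})"
      using S \<sigma>A[of S] by (simp add: subset_Diff_insert in_transpose_image_iff)
  qed (use \<sigma>\<sigma> in auto)
  then show "shapley N v i = shapley N v j" unfolding shapley_def by simp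
qed

text \<open>Exchanging the sums, \<open>v T\<close> occurs positively once for each
  \<open>i \<in> T\<close>, from \<open>S = T - {i}\<close>, and negatively once for each
  \<open>i \<in> A - T\<close>, from \<open>S = T\<close>. For empty \<open>T\<close> the truncated
  \<open>card T - 1\<close> is harmless, as its factor \<open>card T\<close> is 0.\<close>

lemma sum_marginal_contributions:
  fixes v :: "'a set \<Rightarrow> real" and f :: "nat \<Rightarrow> real"
  assumes A: "finite A"
  shows "(\<Sum>i\<in>A. \<Sum>S\<in>Pow (A - {i}). f (card S) * (v (S \<union> {i}) - v S)) =
    (\<Sum>T\<in>Pow A. (real (card T) * f (card T - 1) - real (card A - card T) * f (card T)) * v T)"
proof -
  have "(\<Sum>i\<in>A. \<Sum>S\<in>Pow (A - {i}). f (card S) * v (S \<union> {i})) =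
      (\<Sum>i\<in>A. \<Sum>T\<in>{T \<in> Pow A. i \<in> T}. f (card T - 1) * v T)"
  proof (rule sum.cong[OF refl])
    fix i assume "i \<in> A"
    show "(\<Sum>S\<in>Pow (A - {i}). f (card S) * v (S \<union> {i})) =
        (\<Sum>T\<in>{T \<in> Pow A. i \<in> T}. f (card T - 1) * v T)"
    proof (rule sum.reindex_bij_witness[of _ "\<lambda>T. T - {i}" "\<lambda>S. S \<union> {i}"])
      fix S assume "S \<in> Pow (A - {i})"
      then have "card (S \<union> {i}) = Suc (card S)"
        using A by (subst Un_insert_right, subst Un_empty_right, subst card_insert_disjoint)
          (auto dest: finite_subset)
      then show "f (card (S \<union> {i}) - 1) * v (S \<union> {i}) = f (card S) * v (S \<union> {i})" by simp
    qed (use \<open>i \<in> A\<close> in auto)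
  qed
  also have "\<dots> = (\<Sum>T\<in>Pow A. \<Sum>i\<in>{i \<in> A. i \<in> T}. f (card T - 1) * v T)"
    using A by (intro sum.swap_restrict) auto
  also have "\<dots> = (\<Sum>T\<in>Pow A. real (card T) * f (card T - 1) * v T)"
  proof (rule sum.cong[OF refl])
    fix T assume "T \<in> Pow A"
    then have "{i \<in> A. i \<in> T} = T" by auto
    then show "(\<Sum>i\<in>{i \<in> A. i \<in> T}. f (card T - 1) * v T) = real (card T) * f (card T - 1) * v T"
      by simp
  qed
  finally have joined: "(\<Sum>i\<in>A. \<Sum>S\<in>Pow (A - {i}). f (card S) * v (S \<union> {i})) = \<dots>" .
  have "(\<Sum>i\<in>A. \<Sum>S\<in>Pow (A - {i}). f (card S) * v S) =
      (\<Sum>i\<in>A. \<Sum>T\<in>{T \<in> Pow A. i \<notin> T}. f (card T) * v T)"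
    by (intro sum.cong) auto
  also have "\<dots> = (\<Sum>T\<in>Pow A. \<Sum>i\<in>{i \<in> A. i \<notin> T}. f (card T) * v T)"
    using A by (intro sum.swap_restrict) auto
  also have "\<dots> = (\<Sum>T\<in>Pow A. real (card A - card T) * f (card T) * v T)"
  proof (rule sum.cong[OF refl])
    fix T assume "T \<in> Pow A"
    then have "card {i \<in> A. i \<notin> T} = card A - card T"
      using A card_Diff_subset[of T A] by (auto simp: set_diff_eq dest: finite_subset)
    then show "(\<Sum>i\<in>{i \<in> A. i \<notin> T}. f (card T) * v T) = real (card A - card T) * f (card T) * v T"
      by simp
  qed
  finally have left: "(\<Sum>i\<in>A. \<Sum>S\<in>Pow (A - {i}). f (card S) * v S) = \<dots>" .
  show ?thesis
    using joined left by (simp add: right_diff_distrib left_diff_distrib sum_subtractf)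
qed

text \<open>Cancels the coefficient of \<open>v T\<close> for nonempty proper \<open>T\<close> with
  \<open>t = card T\<close>. By absorption, \<open>t * ((N - 1) choose t)\<close> and
  \<open>(N - t) * ((N - 1) choose (t - 1))\<close> both equal
  \<open>(N - 1) * ((N - 2) choose (t - 1))\<close>; \<open>t < N\<close> makes the binomials
  positive, so one may divide.\<close>

lemma shapley_weights_telescope:
  assumes "0 < t" "t < N"
  shows "real t * inverse (real ((N - 1) choose (t - 1))) =
    real (N - t) * inverse (real ((N - 1) choose t))"
proof -
  obtain s where s: "t = Suc s" using assms by (cases t) auto
  have "t * ((N - 1) choose t) = (N - t) * ((N - 1) choose (t - 1))"
    using binomial_absorb_comp[of "N - 1" s] binomial_absorption[of s "N - 1"] assms s
    by simp
  then have "real t * real ((N - 1) choose t) = real (N - t) * real ((N - 1) choose (t - 1))"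
    by (metis of_nat_mult)
  moreover have "0 < (N - 1) choose t" "0 < (N - 1) choose (t - 1)"
    using assms by (auto intro!: zero_less_binomial)
  ultimately show ?thesis by (simp add: field_simps)
qed

lemma shapley_efficiency: "efficiency N (shapley N)"
  unfolding efficiency_def
proof
  fix v assume v: "v \<in> games N"
  let ?f = "\<lambda>s. inverse (real ((N - 1) choose s))"
  let ?c = "\<lambda>T. (real (card T) * ?f (card T - 1) - real (N - card T) * ?f (card T)) * v T"
  \<comment> \<open>The empty coalition drops out because \<open>v {} = 0\<close>, every other
    proper one because its weights cancel.\<close>
  have zero: "?c T = 0" if T: "T \<in> Pow {1..N} - {{1..N}}" for T
  proof (cases "T = {}")
    case True
    then show ?thesis using v by (simp add: games_def)
  next
    case False
    have "finite T" using T finite_subset by blast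
    then have "0 < card T" using False by (simp add: card_gt_0_iff)
    moreover have "card T < N" using psubset_card_mono[of "{1..N}" T] T by auto
    ultimately show ?thesis using shapley_weights_telescope by simp
  qed
  have "(\<Sum>i\<in>{1..N}. shapley N v i) =
      1 / real N * (\<Sum>i\<in>{1..N}. \<Sum>S\<in>Pow ({1..N} - {i}). ?f (card S) * (v (S \<union> {i}) - v S))"
    unfolding shapley_def by (rule sum_distrib_left[symmetric])
  also have "\<dots> = 1 / real N * (\<Sum>T\<in>Pow {1..N}. ?c T)"
    using sum_marginal_contributions[of "{1..N}" ?f v] by simp
  also have "(\<Sum>T\<in>Pow {1..N}. ?c T) = (\<Sum>T\<in>{{1..N}}. ?c T)"
    by (rule sum.mono_neutral_right) (use zero in auto)
  \<comment> \<open>The coefficient of the grand coalition is \<open>N\<close>, which cancels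
    \<open>1 / real N\<close>. For \<open>N = 0\<close> both sides are 0, as the grand coalition is
    then empty.\<close>
  also have "1 / real N * \<dots> = v {1..N}"
    using v by (cases "N = 0") (auto simp: games_def)
  finally show "(\<Sum>i\<in>{1..N}. shapley N v i) = v {1..N}" .
qed

theorem shapley_axioms_shapley: "shapley_axioms N (shapley N)"
  by (simp add: shapley_axioms_def shapley_efficiency shapley_symmetry shapley_linearity
      shapley_null_player)

theorem corollary3p5:
  fixes N k :: nat and b d :: "nat \<Rightarrow> real" and m :: real
  assumes "persistence_diagram N b d" and "1 \<le> k"
  shows "shapley_axioms N (shapley N) \<and>
    (\<forall>\<psi>. shapley_axioms N \<psi> \<longrightarrow>
      (\<forall>i\<in>{1..N}. \<psi> (landscape_game N b d k m) i = shapley N (landscape_game N b d k m) i))"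
  \<comment> \<open>\<open>1 \<le> k\<close> gives the empty coalition fewer than \<open>k\<close>
    members, hence value 0, so the landscape game is a game.\<close>
  using shapley_axioms_unique[OF _ shapley_axioms_shapley landscape_game_in_games[OF assms(2)]]
    shapley_axioms_shapley
  by simp

end
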